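(* Let $q$ be a prime power and $(u_1,v_1,\dots,u_5,v_5)$ a tuple over $\mathbb{F}_q^*$. In $\Lambda_{5,q}$ there is a cycle of type $(u_1,v_1,\dots,u_5,v_5)$ if and only if there exist $a,b,c,d,r\in\mathbb{F}_q^*$ with $ca^2+c(2b+c)a+b(c+d)(b+c+d)=0$ and $a+b+c+d\ne0$ such that $v_1=a$, $v_2=b$, $v_3=c$, $v_4=d$, $v_5=-(a+b+c+d)$ and $u_1=cr$, $u_2=dr$, $u_3=-(a+b+c+d)r$, $u_4=ar$, $u_5=br$.
   Context: For a prime power $q$ and integer $k\ge2$, $\Lambda_{k,q}$ is the bipartite graph with vertex set $L_k\cup R_k$ (regarded as disjoint), where $L_k$ is the set of vectors $[l]=(l_0,\dots,l_k)\in\mathbb{F}_q^{k+1}$ with $l_1=l_2$ and $R_k$ the set of vectors $\langle r\rangle=(r_0,\dots,r_k)\in\mathbb{F}_q^{k+1}$ with $r_1=0$; edges join only $L_k$ to $R_k$, and $[l]\sim\langle r\rangle$ iff for every $2\le i\le k$: $l_i+r_i=r_0l_{i-2}$ if $i\equiv2,3\pmod4$, and $l_i+r_i=l_0r_{i-2}$ if $i\equiv0,1\pmod4$. A cycle of length $2n$ through the edge joining the two all-zero vectors is written $[l^{(1)}],\langle r^{(1)}\rangle,\dots,[l^{(n)}],\langle r^{(n)}\rangle$ (distinct vertices, consecutive ones adjacent, $\langle r^{(n)}\rangle\sim[l^{(1)}]$) with $[l^{(1)}]$ and $\langle r^{(1)}\rangle$ the all-zero vectors. Put $x_i=l^{(i)}_0$,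 $y_i=r^{(i)}_0$ ($1\le i\le n$), $x_{n+1}=y_{n+1}=0$, $u_i=x_{i+1}-x_i$, $v_i=y_{i+1}-y_i$; the tuple $(u_1,v_1,\dots,u_n,v_n)$ is the type of the cycle, and "there is a cycle of type $\epsilon$" means such a cycle with type $\epsilon$ exists. *)

theory Defs
  imports Main
begin

(* Vectors in F^(k+1) are lists of length k+1, indexed from 0; the finite field F_q is an
   arbitrary type of sort {field, finite}.  The definitions are meant for k >= 2. *)

definition L_vecs :: "nat \<Rightarrow> 'a::field list set" where
  "L_vecs k = {l. length l = k + 1 \<and> l ! 1 = l ! 2}"

definition R_vecs :: "nat \<Rightarrow> 'a::field list set" where
  "R_vecs k = {r. length r = k + 1 \<and> r ! 1 = 0}"

definition incident :: "nat \<Rightarrow> 'a::field list \<Rightarrow> 'a list \<Rightarrow> bool" where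
  "incident k l r \<longleftrightarrow>
     (\<forall>i\<in>{2..k}. l ! i + r ! i =
        (if i mod 4 \<in> {2, 3} then r ! 0 * l ! (i - 2) else l ! 0 * r ! (i - 2)))"

(* Vertices are tagged by Inl / Inr, since L_vecs k and R_vecs k overlap as sets of lists. *)

type_synonym 'a vertex = "'a list + 'a list"

definition Lambda_verts :: "nat \<Rightarrow> 'a::field vertex set" where
  "Lambda_verts k = L_vecs k <+> R_vecs k"

definition Lambda_adj :: "nat \<Rightarrow> 'a::field vertex \<Rightarrow> 'a vertex \<Rightarrow> bool" where
  "Lambda_adj k x y \<longleftrightarrow> x \<in> Lambda_verts k \<and> y \<in> Lambda_verts k \<and>
     (\<exists>l r. incident k l r \<and> (x = Inl l \<and> y = Inr r \<or> x = Inr r \<and> y = Inl l))"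

definition is_cycle :: "('v \<Rightarrow> 'v \<Rightarrow> bool) \<Rightarrow> 'v list \<Rightarrow> bool" where
  "is_cycle E vs \<longleftrightarrow> 3 \<le> length vs \<and> distinct vs \<and>
     (\<forall>i<length vs. E (vs ! i) (vs ! (Suc i mod length vs)))"

(* Only l i and r i with 1 <= i <= n matter. *)

definition zero_edge_cycle ::
  "nat \<Rightarrow> nat \<Rightarrow> (nat \<Rightarrow> 'a::field list) \<Rightarrow> (nat \<Rightarrow> 'a list) \<Rightarrow> bool" where
  "zero_edge_cycle k n l r \<longleftrightarrow>
     is_cycle (Lambda_adj k) (concat (map (\<lambda>i. [Inl (l i), Inr (r i)]) [1..<n + 1])) \<and>
     l 1 = replicate (k + 1) 0 \<and> r 1 = replicate (k + 1) 0"

definition colour :: "nat \<Rightarrow> (nat \<Rightarrow> 'a::field list) \<Rightarrow> nat \<Rightarrow> 'a" where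
  "colour n w i = (if i = n + 1 then 0 else w i ! 0)"

definition cycle_type ::
  "nat \<Rightarrow> (nat \<Rightarrow> 'a::field list) \<Rightarrow> (nat \<Rightarrow> 'a list) \<Rightarrow> 'a list" where
  "cycle_type n l r = concat (map (\<lambda>i.
     [colour n l (i + 1) - colour n l i, colour n r (i + 1) - colour n r i]) [1..<n + 1])"

definition has_cycle_of_type :: "nat \<Rightarrow> 'a::field list \<Rightarrow> bool" where
  "has_cycle_of_type k \<epsilon> \<longleftrightarrow>
     (\<exists>n l r. zero_edge_cycle k n l r \<and> cycle_type n l r = \<epsilon>)"

end

theory Submission
  imports Defs
begin

text \<open>
  A walk from the zero edge is determined by its colours, so a tuple is the type of a closed walk
  of length 10 iff its entries satisfy six polynomial equations (\<open>closed_type\<close>), and non-zero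
  entries force the walk to be a cycle because the graph has no 4-cycles. The system is
  invariant under rotation of the type, and its ideal contains
  \<open>u\<^sub>2v\<^sub>1v\<^sub>2(u\<^sub>3v\<^sub>3 - u\<^sub>1v\<^sub>5)\<close>. With indices modulo 5, this
  says that \<open>u\<^bsub>i\<^esub>/v\<^bsub>i+2\<^esub>\<close> does not change under \<open>i \<mapsto> i + 2\<close>,
  so it is a constant \<open>r\<close>. Substituting \<open>u\<^bsub>i\<^esub> = r v\<^bsub>i+2\<^esub>\<close> reduces
  the system to the cubic equation.
\<close>

section \<open>The polynomial system and its solutions\<close>

text \<open>
  The last four equations say that the vertex \<open>\<langle>r\<^bsup>(5)\<^esup>\<rangle>\<close> reached by the walk has zero
  coordinates 2 to 5.
\<close>

definition closed_type ::
  "'a::field \<Rightarrow> 'a \<Rightarrow> 'a \<Rightarrow> 'a \<Rightarrow> 'a \<Rightarrow> 'a \<Rightarrow> 'a \<Rightarrow> 'a \<Rightarrow> 'a \<Rightarrow> 'a \<Rightarrow> bool" where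
  "closed_type u1 v1 u2 v2 u3 v3 u4 v4 u5 v5 \<longleftrightarrow>
     u1 + u2 + u3 + u4 + u5 = 0 \<and> v1 + v2 + v3 + v4 + v5 = 0 \<and>
     v1 * u1 + v2 * (u1 + u2) + v3 * (u1 + u2 + u3) + v4 * (u1 + u2 + u3 + u4) = 0 \<and>
     v2 * (u2 * v1) + v3 * (u2 * v1 + u3 * (v1 + v2)) +
     v4 * (u2 * v1 + u3 * (v1 + v2) + u4 * (v1 + v2 + v3)) = 0 \<and>
     v1 * u1^2 + v2 * (u1 + u2)^2 + v3 * (u1 + u2 + u3)^2 + v4 * (u1 + u2 + u3 + u4)^2 = 0 \<and>
     v2 * (u1 + u2) * (u2 * v1) + v3 * (u1 + u2 + u3) * (u2 * v1 + u3 * (v1 + v2)) +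
     v4 * (u1 + u2 + u3 + u4) * (u2 * v1 + u3 * (v1 + v2) + u4 * (v1 + v2 + v3)) = 0"

text \<open>Transports \<open>closed_type_ratio\<close> to every position of the type. Each rotated
  equation is a polynomial consequence of the original six.\<close>

lemma closed_type_rotate:
  assumes "closed_type u1 v1 u2 v2 u3 v3 u4 v4 u5 v5"
  shows "closed_type u2 v2 u3 v3 u4 v4 u5 v5 u1 v1"
  using assms unfolding closed_type_def by (elim conjE, intro conjI) algebra+

lemma closed_type_ratio:
  assumes "closed_type u1 v1 u2 v2 u3 v3 u4 v4 u5 v5" "u2 \<noteq> 0" "v1 \<noteq> 0" "v2 \<noteq> 0"
  shows "u3 * v3 = u1 * v5"
proof -
  have "u2 * v1 * v2 * (u3 * v3 - u1 * v5) = 0"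
    using assms(1) unfolding closed_type_def by (elim conjE) algebra
  then show ?thesis using assms by simp
qed

text \<open>Under this substitution the first three equations of \<open>closed_type\<close> hold
  identically, and the left-hand sides of the last three become the cubic times \<open>-r\<close>,
  \<open>r^2\<close> and \<open>r^2 * (a + b)\<close> respectively.\<close>

lemma closed_type_proportional_iff:
  assumes "r \<noteq> 0" "e = - (a + b + c + d)"
  shows "closed_type (c * r) a (d * r) b (e * r) c (a * r) d (b * r) e \<longleftrightarrow>
    c * a^2 + c * (2 * b + c) * a + b * (c + d) * (b + c + d) = 0" (is "?L \<longleftrightarrow> ?P = 0")
proof
  assume ?L
  then have "r * ?P = 0"
    using assms(2) unfolding closed_type_def by (elim conjE) algebra
  then show "?P = 0" using assms(1) by simp
next
  assume "?P = 0"
  then show ?L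
    using assms(2) unfolding closed_type_def by (intro conjI) algebra+
qed

lemma closed_type_iff:
  assumes nz: "u1 \<noteq> 0" "v1 \<noteq> 0" "u2 \<noteq> 0" "v2 \<noteq> 0" "u3 \<noteq> 0" "v3 \<noteq> 0"
    "u4 \<noteq> 0" "v4 \<noteq> 0" "u5 \<noteq> 0" "v5 \<noteq> 0"
  shows "closed_type u1 v1 u2 v2 u3 v3 u4 v4 u5 v5 \<longleftrightarrow>
    (\<exists>a b c d r. a \<noteq> 0 \<and> b \<noteq> 0 \<and> c \<noteq> 0 \<and> d \<noteq> 0 \<and> r \<noteq> 0 \<and>
      c * a^2 + c * (2 * b + c) * a + b * (c + d) * (b + c + d) = 0 \<and>
      a + b + c + d \<noteq> 0 \<and>
      v1 = a \<and> v2 = b \<and> v3 = c \<and> v4 = d \<and> v5 = - (a + b + c + d) \<and>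
      u1 = c * r \<and> u2 = d * r \<and> u3 = - (a + b + c + d) * r \<and> u4 = a * r \<and> u5 = b * r)"
    (is "?C \<longleftrightarrow> ?E")
proof
  assume c1: ?C
  note c2 = closed_type_rotate[OF c1]
  note c3 = closed_type_rotate[OF c2]
  note c4 = closed_type_rotate[OF c3]
  note c5 = closed_type_rotate[OF c4]
  \<comment> \<open>The ratio is read off at index 1 and carried along 1, 3, 5, 2, 4 in steps of 2
    modulo 5; hence the rotations are used in the order \<open>c1\<close>, \<open>c3\<close>,
    \<open>c5\<close>, \<open>c2\<close>.\<close>
  define r where "r = u1 / v3"
  have v5: "v5 = - (v1 + v2 + v3 + v4)"
    using c1 unfolding closed_type_def by (simp add: add_eq_0_iff)
  have u1: "u1 = v3 * r" and r: "r \<noteq> 0" using nz by (simp_all add: r_def)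
  have "u3 * v3 = u1 * v5" by (rule closed_type_ratio[OF c1]) (use nz in auto)
  then have u3: "u3 = v5 * r" using nz u1 by simp
  have "u5 * v5 = u3 * v2" by (rule closed_type_ratio[OF c3]) (use nz in auto)
  then have u5: "u5 = v2 * r" using nz u3 by simp
  have "u2 * v2 = u5 * v4" by (rule closed_type_ratio[OF c5]) (use nz in auto)
  then have u2: "u2 = v4 * r" using nz u5 by simp
  have "u4 * v4 = u2 * v1" by (rule closed_type_ratio[OF c2]) (use nz in auto)
  then have u4: "u4 = v1 * r" using nz u2 by simp
  have "v3 * v1^2 + v3 * (2 * v2 + v3) * v1 + v2 * (v3 + v4) * (v2 + v3 + v4) = 0"
    using c1 closed_type_proportional_iff[OF r v5] by (simp only: u1 u2 u3 u4 u5)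
  moreover have "v1 + v2 + v3 + v4 \<noteq> 0" using nz(10) v5 by force
  ultimately show ?E
    by (intro exI[of _ v1] exI[of _ v2] exI[of _ v3] exI[of _ v4] exI[of _ r])
      (use nz r u1 u2 u3 u4 u5 v5 in blast)
next
  assume ?E
  then show ?C
    by (elim exE conjE) (simp only: closed_type_proportional_iff[OF _ refl] not_False_eq_True)
qed

section \<open>Adjacency for k = 5\<close>

lemma Lambda_adj_sym: "Lambda_adj k x y \<longleftrightarrow> Lambda_adj k y x"
  unfolding Lambda_adj_def by blast

lemma Lambda_adj_5_iff:
  "Lambda_adj 5 (Inl l) (Inr r) \<longleftrightarrow>
     length l = 6 \<and> length r = 6 \<and> l ! 1 = l ! 2 \<and> r ! 1 = 0 \<and>
     l ! 2 + r ! 2 = r ! 0 * l ! 0 \<and> l ! 3 + r ! 3 = r ! 0 * l ! 1 \<and>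
     l ! 4 + r ! 4 = l ! 0 * r ! 2 \<and> l ! 5 + r ! 5 = l ! 0 * r ! 3"
proof -
  have "Lambda_adj 5 (Inl l) (Inr r) \<longleftrightarrow> l \<in> L_vecs 5 \<and> r \<in> R_vecs 5 \<and> incident 5 l r"
    unfolding Lambda_adj_def Lambda_verts_def by blast
  moreover have "{2..5::nat} = {2, 3, 4, 5}" by auto
  ultimately show ?thesis
    by (simp add: L_vecs_def R_vecs_def incident_def conj_ac)
qed

text \<open>In the alternating sum of the equations for coordinate 2 over the four edges, the
  coordinates with index 2 cancel and the product of the two colour differences remains.\<close>

lemma Lambda_adj_5_no_square:
  fixes l l' r r' :: "'a::field list"
  assumes "Lambda_adj 5 (Inl l) (Inr r)" "Lambda_adj 5 (Inl l) (Inr r')"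
    "Lambda_adj 5 (Inl l') (Inr r)" "Lambda_adj 5 (Inl l') (Inr r')"
  shows "l ! 0 = l' ! 0 \<or> r ! 0 = r' ! 0"
proof -
  have eq: "l ! 2 + r ! 2 = r ! 0 * l ! 0" if "Lambda_adj 5 (Inl l) (Inr r)" for l r :: "'a list"
    using that by (simp only: Lambda_adj_5_iff)
  have "(l ! 0 - l' ! 0) * (r ! 0 - r' ! 0) = 0"
    using eq[OF assms(1)] eq[OF assms(2)] eq[OF assms(3)] eq[OF assms(4)] by algebra
  then show ?thesis by simp
qed

text \<open>If a walk \<open>l\<close>, \<open>r\<close>, \<open>l'\<close>, \<open>r'\<close>,
  \<open>l''\<close> returned to \<open>l\<close>, then \<open>l\<close> and \<open>l'\<close> would
  share the neighbours \<open>r\<close> and \<open>r'\<close>, a 4-cycle with distinct colours on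
  both sides.\<close>

lemma left_vertices_distinct:
  assumes "Lambda_adj 5 (Inl l) (Inr r)" "Lambda_adj 5 (Inl l') (Inr r)"
    "Lambda_adj 5 (Inl l') (Inr r')" "Lambda_adj 5 (Inl l'') (Inr r')"
    "l ! 0 \<noteq> l' ! 0" "r ! 0 \<noteq> r' ! 0"
  shows "l \<noteq> l''"
  using Lambda_adj_5_no_square assms by blast

lemma right_vertices_distinct:
  assumes "Lambda_adj 5 (Inl l) (Inr r)" "Lambda_adj 5 (Inl l) (Inr r')"
    "Lambda_adj 5 (Inl l') (Inr r')" "Lambda_adj 5 (Inl l') (Inr r'')"
    "l ! 0 \<noteq> l' ! 0" "r ! 0 \<noteq> r' ! 0"
  shows "r \<noteq> r''"
  using Lambda_adj_5_no_square assms by blast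

text \<open>The adjacency equations are triangular: once the colour \<open>x\<close> is chosen, they
  give the remaining coordinates one after another. \<open>right_neighbour\<close> solves them from
  the other side.\<close>

definition left_neighbour :: "'a::field \<Rightarrow> 'a list \<Rightarrow> 'a list" where
  "left_neighbour x r = (let m = r ! 0 * x - r ! 2
     in [x, m, m, r ! 0 * m - r ! 3, x * r ! 2 - r ! 4, x * r ! 3 - r ! 5])"

definition right_neighbour :: "'a::field \<Rightarrow> 'a list \<Rightarrow> 'a list" where
  "right_neighbour y l = (let m = y * l ! 0 - l ! 2; p = y * l ! 1 - l ! 3
     in [y, 0, m, p, l ! 0 * m - l ! 4, l ! 0 * p - l ! 5])"

lemma Lambda_adj_5_left_neighbour:
  assumes "length r = 6" "r ! 1 = 0"
  shows "Lambda_adj 5 (Inl (left_neighbour x r)) (Inr r)"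
  using assms by (simp add: Lambda_adj_5_iff left_neighbour_def Let_def)

lemma Lambda_adj_5_right_neighbour:
  assumes "length l = 6" "l ! 1 = l ! 2"
  shows "Lambda_adj 5 (Inl l) (Inr (right_neighbour y l))"
  using assms by (simp add: Lambda_adj_5_iff right_neighbour_def Let_def)

section \<open>Closed walks of length ten and their types\<close>

lemma upt_1_6: "[Suc 0..<6] = [1, 2, 3, 4, 5]"
  by (simp add: upt_rec)

lemma length_cycle_type: "length (cycle_type n l r) = 2 * n"
  by (simp add: cycle_type_def length_concat comp_def sum_list_triv)

lemma cycle_type_5:
  "cycle_type 5 l r =
    [l 2 ! 0 - l 1 ! 0, r 2 ! 0 - r 1 ! 0, l 3 ! 0 - l 2 ! 0, r 3 ! 0 - r 2 ! 0,
     l 4 ! 0 - l 3 ! 0, r 4 ! 0 - r 3 ! 0, l 5 ! 0 - l 4 ! 0, r 5 ! 0 - r 4 ! 0,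
     - (l 5 ! 0), - (r 5 ! 0)]"
  by (simp add: cycle_type_def colour_def upt_1_6 flip: numeral_2_eq_2)

lemma zero_edge_cycle_5_iff:
  "zero_edge_cycle 5 5 l r \<longleftrightarrow> l 1 = replicate 6 0 \<and> r 1 = replicate 6 0 \<and>
     distinct [l 1, l 2, l 3, l 4, l 5] \<and> distinct [r 1, r 2, r 3, r 4, r 5] \<and>
     Lambda_adj 5 (Inl (l 1)) (Inr (r 1)) \<and> Lambda_adj 5 (Inl (l 2)) (Inr (r 1)) \<and>
     Lambda_adj 5 (Inl (l 2)) (Inr (r 2)) \<and> Lambda_adj 5 (Inl (l 3)) (Inr (r 2)) \<and>
     Lambda_adj 5 (Inl (l 3)) (Inr (r 3)) \<and> Lambda_adj 5 (Inl (l 4)) (Inr (r 3)) \<and>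
     Lambda_adj 5 (Inl (l 4)) (Inr (r 4)) \<and> Lambda_adj 5 (Inl (l 5)) (Inr (r 4)) \<and>
     Lambda_adj 5 (Inl (l 5)) (Inr (r 5)) \<and> Lambda_adj 5 (Inl (l 1)) (Inr (r 5))"
proof -
  define vs where "vs = [Inl (l 1), Inr (r 1), Inl (l 2), Inr (r 2), Inl (l 3), Inr (r 3),
    Inl (l 4), Inr (r 4), Inl (l 5), Inr (r 5)]"
  have vs: "concat (map (\<lambda>i. [Inl (l i), Inr (r i)]) [1..<5 + 1]) = vs" "length vs = 10"
    by (simp_all add: vs_def upt_1_6)
  have less_10: "(\<forall>i<10. P i) \<longleftrightarrow> P 0 \<and> P 1 \<and> P 2 \<and> P 3 \<and> P 4 \<and> P 5 \<and> P 6 \<and> P 7 \<and> P 8 \<and> P 9"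
    for P :: "nat \<Rightarrow> bool"
    by (simp add: numeral_eq_Suc All_less_Suc2)
  \<comment> \<open>The tags separate left from right vertices, so only pairs on the same side have
    to be compared.\<close>
  have "distinct vs \<longleftrightarrow> distinct [l 1, l 2, l 3, l 4, l 5] \<and> distinct [r 1, r 2, r 3, r 4, r 5]"
    unfolding vs_def by simp (rule iffI; elim conjE; intro conjI; assumption)
  then show ?thesis
    unfolding zero_edge_cycle_def is_cycle_def vs less_10
    by (simp add: vs_def Lambda_adj_sym[of _ "Inr _" "Inl _"])
      (rule iffI; elim conjE; intro conjI; assumption)
qed

text \<open>Only the edge from \<open>r5\<close> back to the zero left vertex is in question;
  \<open>z\<close> is the zero vector on both sides. Both directions of the characterisation use
  this, for a given cycle and for a constructed walk.\<close>

lemma walk_closes_iff: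
  fixes u1 v1 u2 v2 u3 v3 u4 v4 u5 v5 :: "'a::field"
  assumes adj: "Lambda_adj 5 (Inl l2) (Inr z)" "Lambda_adj 5 (Inl l2) (Inr r2)"
    "Lambda_adj 5 (Inl l3) (Inr r2)" "Lambda_adj 5 (Inl l3) (Inr r3)"
    "Lambda_adj 5 (Inl l4) (Inr r3)" "Lambda_adj 5 (Inl l4) (Inr r4)"
    "Lambda_adj 5 (Inl l5) (Inr r4)" "Lambda_adj 5 (Inl l5) (Inr r5)"
  and z: "z = replicate 6 0"
  and colours: "l2 ! 0 = u1" "r2 ! 0 = v1" "l3 ! 0 = u1 + u2" "r3 ! 0 = v1 + v2"
    "l4 ! 0 = u1 + u2 + u3" "r4 ! 0 = v1 + v2 + v3"
    "l5 ! 0 = u1 + u2 + u3 + u4" "r5 ! 0 = v1 + v2 + v3 + v4"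
  and sum: "u1 + u2 + u3 + u4 + u5 = 0" "v1 + v2 + v3 + v4 + v5 = 0"
  shows "Lambda_adj 5 (Inl z) (Inr r5) \<longleftrightarrow> closed_type u1 v1 u2 v2 u3 v3 u4 v4 u5 v5"
proof -
  \<comment> \<open>The equations of an edge are solved for its later vertex, \<open>left\<close>
    when the walk enters a left vertex and \<open>right\<close> when it enters a right one.
    Rewriting with \<open>coords\<close> thus runs back from \<open>r5\<close> to
    \<open>z\<close>.\<close>
  have left: "l ! Suc 0 = l ! 2" "l ! 2 = r ! 0 * l ! 0 - r ! 2" "l ! 3 = r ! 0 * l ! 1 - r ! 3"
      "l ! 4 = l ! 0 * r ! 2 - r ! 4" "l ! 5 = l ! 0 * r ! 3 - r ! 5"
    and right: "r ! 2 = r ! 0 * l ! 0 - l ! 2" "r ! 3 = r ! 0 * l ! 1 - l ! 3"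
      "r ! 4 = l ! 0 * r ! 2 - l ! 4" "r ! 5 = l ! 0 * r ! 3 - l ! 5"
    if "Lambda_adj 5 (Inl l) (Inr r)" for l r :: "'a list"
    using that by (simp_all add: Lambda_adj_5_iff eq_diff_eq add.commute)
  note coords = left[OF adj(1)] right[OF adj(2)] left[OF adj(3)] right[OF adj(4)]
    left[OF adj(5)] right[OF adj(6)] left[OF adj(7)] right[OF adj(8)]
  have "r5 ! 2 = v1 * u1 + v2 * (u1 + u2) + v3 * (u1 + u2 + u3) + v4 * (u1 + u2 + u3 + u4)"
    "r5 ! 3 = v2 * (u2 * v1) + v3 * (u2 * v1 + u3 * (v1 + v2)) +
      v4 * (u2 * v1 + u3 * (v1 + v2) + u4 * (v1 + v2 + v3))"
    "r5 ! 4 = v1 * u1^2 + v2 * (u1 + u2)^2 + v3 * (u1 + u2 + u3)^2 +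
      v4 * (u1 + u2 + u3 + u4)^2"
    "r5 ! 5 = v2 * (u1 + u2) * (u2 * v1) + v3 * (u1 + u2 + u3) * (u2 * v1 + u3 * (v1 + v2)) +
      v4 * (u1 + u2 + u3 + u4) * (u2 * v1 + u3 * (v1 + v2) + u4 * (v1 + v2 + v3))"
    by (simp_all add: coords colours z algebra_simps power2_eq_square)
  note end_coords = this
  have "Lambda_adj 5 (Inl z) (Inr r5) \<longleftrightarrow>
      r5 ! 2 = 0 \<and> r5 ! 3 = 0 \<and> r5 ! 4 = 0 \<and> r5 ! 5 = 0"
    using adj(8) by (simp add: Lambda_adj_5_iff z)
  also have "\<dots> \<longleftrightarrow> closed_type u1 v1 u2 v2 u3 v3 u4 v4 u5 v5"
    unfolding end_coords closed_type_def by (simp only: sum simp_thms)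
  finally show ?thesis .
qed

lemma has_cycle_of_type_5_iff:
  fixes u1 v1 u2 v2 u3 v3 u4 v4 u5 v5 :: "'a::field"
  assumes nz: "u1 \<noteq> 0" "v1 \<noteq> 0" "u2 \<noteq> 0" "v2 \<noteq> 0" "u3 \<noteq> 0" "v3 \<noteq> 0"
    "u4 \<noteq> 0" "v4 \<noteq> 0" "u5 \<noteq> 0" "v5 \<noteq> 0"
  shows "has_cycle_of_type 5 [u1, v1, u2, v2, u3, v3, u4, v4, u5, v5] \<longleftrightarrow>
    closed_type u1 v1 u2 v2 u3 v3 u4 v4 u5 v5" (is "has_cycle_of_type 5 ?\<epsilon> \<longleftrightarrow> ?C")
proof
  assume "has_cycle_of_type 5 ?\<epsilon>"
  then obtain n l r where cycle: "zero_edge_cycle 5 n l r" and type: "cycle_type n l r = ?\<epsilon>"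
    unfolding has_cycle_of_type_def by blast
  \<comment> \<open>The type has two entries for each index and the given tuple has ten.\<close>
  have n: "n = 5" using arg_cong[OF type, of length] by (simp add: length_cycle_type)
  note cycle = cycle[unfolded n zero_edge_cycle_5_iff]
  have zero: "l 1 = replicate 6 0" "r 1 = replicate 6 0" using cycle by blast+
  note adj = cycle[unfolded zero]
  have u: "u1 = l 2 ! 0" "u2 = l 3 ! 0 - l 2 ! 0" "u3 = l 4 ! 0 - l 3 ! 0"
      "u4 = l 5 ! 0 - l 4 ! 0" "u5 = - (l 5 ! 0)"
    and v: "v1 = r 2 ! 0" "v2 = r 3 ! 0 - r 2 ! 0" "v3 = r 4 ! 0 - r 3 ! 0"
      "v4 = r 5 ! 0 - r 4 ! 0" "v5 = - (r 5 ! 0)"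
    using type zero unfolding n cycle_type_5 by auto
  have "Lambda_adj 5 (Inl (replicate 6 0)) (Inr (r 5)) \<longleftrightarrow> ?C"
    by (rule walk_closes_iff[of "l 2" _ "r 2" "l 3" "r 3" "l 4" "r 4" "l 5"])
      (use adj in \<open>simp_all add: u v\<close>)
  then show ?C using adj by blast
next
  assume C: ?C
  define z :: "'a list" where "z = replicate 6 0"
  \<comment> \<open>The colours of the walk have to be the partial sums of the type.\<close>
  define l2 where "l2 = left_neighbour u1 z"
  define r2 where "r2 = right_neighbour v1 l2"
  define l3 where "l3 = left_neighbour (u1 + u2) r2"
  define r3 where "r3 = right_neighbour (v1 + v2) l3"
  define l4 where "l4 = left_neighbour (u1 + u2 + u3) r3"
  define r4 where "r4 = right_neighbour (v1 + v2 + v3) l4"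
  define l5 where "l5 = left_neighbour (u1 + u2 + u3 + u4) r4"
  define r5 where "r5 = right_neighbour (v1 + v2 + v3 + v4) l5"
  have a11: "Lambda_adj 5 (Inl z) (Inr z)"
    by (simp add: Lambda_adj_5_iff z_def)
  have colours: "z ! 0 = 0" "l2 ! 0 = u1" "r2 ! 0 = v1" "l3 ! 0 = u1 + u2" "r3 ! 0 = v1 + v2"
    "l4 ! 0 = u1 + u2 + u3" "r4 ! 0 = v1 + v2 + v3"
    "l5 ! 0 = u1 + u2 + u3 + u4" "r5 ! 0 = v1 + v2 + v3 + v4"
    by (simp_all add: z_def l2_def r2_def l3_def r3_def l4_def r4_def l5_def r5_def
        left_neighbour_def right_neighbour_def Let_def)
  have z: "length z = 6" "z ! 1 = 0" by (simp_all add: z_def)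
  have a21: "Lambda_adj 5 (Inl l2) (Inr z)"
    unfolding l2_def using z by (rule Lambda_adj_5_left_neighbour)
  have a22: "Lambda_adj 5 (Inl l2) (Inr r2)"
    unfolding r2_def by (rule Lambda_adj_5_right_neighbour) (use a21 in \<open>simp_all add: Lambda_adj_5_iff\<close>)
  have a32: "Lambda_adj 5 (Inl l3) (Inr r2)"
    unfolding l3_def by (rule Lambda_adj_5_left_neighbour) (use a22 in \<open>simp_all add: Lambda_adj_5_iff\<close>)
  have a33: "Lambda_adj 5 (Inl l3) (Inr r3)"
    unfolding r3_def by (rule Lambda_adj_5_right_neighbour) (use a32 in \<open>simp_all add: Lambda_adj_5_iff\<close>)
  have a43: "Lambda_adj 5 (Inl l4) (Inr r3)"
    unfolding l4_def by (rule Lambda_adj_5_left_neighbour) (use a33 in \<open>simp_all add: Lambda_adj_5_iff\<close>)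
  have a44: "Lambda_adj 5 (Inl l4) (Inr r4)"
    unfolding r4_def by (rule Lambda_adj_5_right_neighbour) (use a43 in \<open>simp_all add: Lambda_adj_5_iff\<close>)
  have a54: "Lambda_adj 5 (Inl l5) (Inr r4)"
    unfolding l5_def by (rule Lambda_adj_5_left_neighbour) (use a44 in \<open>simp_all add: Lambda_adj_5_iff\<close>)
  have a55: "Lambda_adj 5 (Inl l5) (Inr r5)"
    unfolding r5_def by (rule Lambda_adj_5_right_neighbour) (use a54 in \<open>simp_all add: Lambda_adj_5_iff\<close>)
  have "u1 + u2 + u3 + u4 + u5 = 0" "v1 + v2 + v3 + v4 + v5 = 0"
    using C by (simp_all add: closed_type_def)
  then have a15: "Lambda_adj 5 (Inl z) (Inr r5)"
    using walk_closes_iff[OF a21 a22 a32 a33 a43 a44 a54 a55 z_def colours(2-9)] C by blast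
  have sum: "u5 = - (u1 + u2 + u3 + u4)" "v5 = - (v1 + v2 + v3 + v4)"
    using C unfolding closed_type_def by (simp_all add: add_eq_0_iff)
  \<comment> \<open>The entries with index 0 are irrelevant: cycles are indexed from 1.\<close>
  define l where "l = (!) [z, z, l2, l3, l4, l5]"
  define r where "r = (!) [z, z, r2, r3, r4, r5]"
  have lr: "l 1 = z" "l 2 = l2" "l 3 = l3" "l 4 = l4" "l 5 = l5"
    "r 1 = z" "r 2 = r2" "r 3 = r3" "r 4 = r4" "r 5 = r5"
    by (simp_all add: l_def r_def)
  \<comment> \<open>These are the colours of \<open>l5\<close> and \<open>r5\<close>; being
    non-zero, they differ from the colour of \<open>z\<close>, so colours also change where the walk
    closes.\<close>
  have sum_nz: "u1 + u2 + u3 + u4 \<noteq> 0" "v1 + v2 + v3 + v4 \<noteq> 0"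
    using nz(9,10) sum by force+
  have x: "z ! 0 \<noteq> l2 ! 0" "l2 ! 0 \<noteq> l3 ! 0" "l3 ! 0 \<noteq> l4 ! 0" "l4 ! 0 \<noteq> l5 ! 0" "l5 ! 0 \<noteq> z ! 0"
    and y: "z ! 0 \<noteq> r2 ! 0" "r2 ! 0 \<noteq> r3 ! 0" "r3 ! 0 \<noteq> r4 ! 0" "r4 ! 0 \<noteq> r5 ! 0" "r5 ! 0 \<noteq> z ! 0"
    using nz sum_nz by (auto simp: colours)
  \<comment> \<open>Two of five cyclically ordered vertices are one or two places apart. In the
    first case their colours differ; the second is excluded by the absence of 4-cycles.\<close>
  have dl: "distinct [z, l2, l3, l4, l5]"
    using x left_vertices_distinct[OF a11 a21 a22 a32] left_vertices_distinct[OF a22 a32 a33 a43]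
      left_vertices_distinct[OF a33 a43 a44 a54] left_vertices_distinct[OF a44 a54 a55 a15]
      left_vertices_distinct[OF a55 a15 a11 a21] y
    by auto
  have dr: "distinct [z, r2, r3, r4, r5]"
    using y right_vertices_distinct[OF a21 a22 a32 a33] right_vertices_distinct[OF a32 a33 a43 a44]
      right_vertices_distinct[OF a43 a44 a54 a55] right_vertices_distinct[OF a54 a55 a15 a11]
      right_vertices_distinct[OF a15 a11 a21 a22] x
    by auto
  have "zero_edge_cycle 5 5 l r"
    using a11 a21 a22 a32 a33 a43 a44 a54 a55 a15 dl dr
    unfolding zero_edge_cycle_5_iff lr z_def by blast
  moreover have "cycle_type 5 l r = ?\<epsilon>"
    unfolding cycle_type_5 lr colours by (simp add: sum)
  ultimately show "has_cycle_of_type 5 ?\<epsilon>"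
    unfolding has_cycle_of_type_def by blast
qed

theorem theorem3:
  fixes u1 v1 u2 v2 u3 v3 u4 v4 u5 v5 :: "'a::{field, finite}"
  assumes "u1 \<noteq> 0" "v1 \<noteq> 0" "u2 \<noteq> 0" "v2 \<noteq> 0" "u3 \<noteq> 0" "v3 \<noteq> 0"
    "u4 \<noteq> 0" "v4 \<noteq> 0" "u5 \<noteq> 0" "v5 \<noteq> 0"
  shows "has_cycle_of_type 5 [u1, v1, u2, v2, u3, v3, u4, v4, u5, v5] \<longleftrightarrow>
    (\<exists>a b c d r :: 'a. a \<noteq> 0 \<and> b \<noteq> 0 \<and> c \<noteq> 0 \<and> d \<noteq> 0 \<and> r \<noteq> 0 \<and>
      c * a^2 + c * (2 * b + c) * a + b * (c + d) * (b + c + d) = 0 \<and>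
      a + b + c + d \<noteq> 0 \<and>
      v1 = a \<and> v2 = b \<and> v3 = c \<and> v4 = d \<and> v5 = - (a + b + c + d) \<and>
      u1 = c * r \<and> u2 = d * r \<and> u3 = - (a + b + c + d) * r \<and> u4 = a * r \<and> u5 = b * r)"
  unfolding has_cycle_of_type_5_iff[OF assms] closed_type_iff[OF assms] ..

end
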